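(* Let $\Theta^* \in \mathbb{R}^{k\times p}$, let $X_1,\dots,X_N\in\mathbb{R}^{k\times p}$ and $\vec{\varepsilon}\in\mathbb{R}^N$, and let $\vec{y} = \mathfrak{X}(\Theta^* ) + \vec{\varepsilon}$, where $[\mathfrak{X}(\Theta)]_i = \operatorname{trace}(X_i^T\Theta)$. Let $r$ be a positive integer with $r\le \min\{k,p\}$ and let $\delta \ge 0$. Suppose that the operator $\mathfrak{X}$ satisfies restricted strong convexity with parameter $\kappa(\mathfrak{X})>0$ over the set $\mathcal{C}(r;\delta)$, and that the regularization parameter $\lambda_N>0$ satisfies $\lambda_N \ge 2\,\|\mathfrak{X}^*(\vec{\varepsilon})\|_{\mathrm{op}}/N$. Then any solution $$\widehat\Theta \in \arg\min_{\Theta\in\mathbb{R}^{k\times p}} \Big\{ \frac{1}{2N}\|\vec{y}-\mathfrak{X}(\Theta)\|_2^2 + \lambda_N \|\Theta\|_1\Big\}$$ satisfies $$\|\widehat\Theta-\Theta^*\|_F \le \max\left\{ \delta,\ \frac{32\,\lambda_N\sqrt{r}}{\kappa(\mathfrak{X})},\ \left[\frac{16\,\lambda_N\,\|\Pi_{\mathcal{M}^\perp(U^r,V^r)}(\Theta^* )\|_1}{\kappa(\mathfrak{X})}\right]^{1/2}\right\}.$$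
   Context: For a matrix $\Theta$, $\|\Theta\|_1$ denotes the nuclear norm (sum of singular values), $\|\Theta\|_{\mathrm{op}}$ the largest singular value, and $\|\Theta\|_F$ the Frobenius norm. The adjoint of $\mathfrak{X}:\mathbb{R}^{k\times p}\to\mathbb{R}^N$ is $\mathfrak{X}^*(\vec\varepsilon)=\sum_{i=1}^N \varepsilon_i X_i$. Fix a singular value decomposition of $\Theta^*$ with singular values in non-increasing order. For a positive integer $r\le\min\{k,p\}$, $U^r\in\mathbb{R}^{k\times r}$ and $V^r\in\mathbb{R}^{p\times r}$ are the matrices with orthonormal columns consisting of the top $r$ left and right singular vectors of $\Theta^*$. For matrices $U\in\mathbb{R}^{k\times r}$, $V\in\mathbb{R}^{p\times r}$ with orthonormal columns, $\mathcal{M}^\perp(U,V)$ is the subspace of matrices $\Theta\in\mathbb{R}^{k\times p}$ whose row space is orthogonal to the column span of $V$ and whose column space is orthogonal to the column span of $U$; $\Pi_{\mathcal{M}^\perp(U,V)}$ is the orthogonal projection onto it, i.e. $\Theta\mapsto (I-UU^T)\Theta(I-VV^T)$. For $\Delta\in\mathbb{R}^{k\times p}$ write $\Delta''=\Pi_{\mathcal{M}^\perp(U^r,V^r)}(\Delta)$ and $\Delta'=\Delta-\Delta''$. Define $$\mathcal{C}(r;\delta)=\Big\{\Delta\in\mathbb{R}^{k\times p}\ :\ \|\Delta\|_F\ge\delta,\ \|\Delta''\|_1\le 3\|\Delta'\|_1+4\|\Pi_{\mathcal{M}^\perp(U^r,V^r)}(\Theta^* )\|_1\Big\}.$$ The operator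 $\mathfrak{X}$ satisfies restricted strong convexity (RSC) with parameter $\kappa(\mathfrak{X})>0$ over a set $\mathcal{C}$ if $\frac{1}{2N}\|\mathfrak{X}(\Delta)\|_2^2\ge\kappa(\mathfrak{X})\|\Delta\|_F^2$ for all $\Delta\in\mathcal{C}$. *)

theory Defs
  imports "HOL-Analysis.Analysis"
begin

text \<open>
  A \<open>k\<times>p\<close> matrix has type \<^typ>\<open>real ^ 'p ^ 'k\<close>, so \<^const>\<open>norm\<close> on matrices is the
  Frobenius norm and \<open>(\<bullet>)\<close> is the trace inner product.
\<close>

section \<open>Singular values\<close>

definition singular_vals :: "real ^ 'p ^ 'k \<Rightarrow> real set" where
  "singular_vals A =
     {\<sigma>. \<sigma> \<ge> 0 \<and> (\<exists>v. v \<noteq> 0 \<and> (transpose A ** A) *v v = \<sigma>\<^sup>2 *\<^sub>R v)}"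

definition sv_multiplicity :: "real ^ 'p ^ 'k \<Rightarrow> real \<Rightarrow> nat" where
  "sv_multiplicity A \<sigma> = dim {v. (transpose A ** A) *v v = \<sigma>\<^sup>2 *\<^sub>R v}"

text \<open>
  For \<open>p > k\<close> the matrix \<open>A\<^sup>TA\<close> has additional zero eigenvalues compared with \<open>AA\<^sup>T\<close>. They
  change neither the sum nor the maximum of the singular values.
\<close>

definition nuclear_norm :: "real ^ 'p ^ 'k \<Rightarrow> real" where
  "nuclear_norm A = (\<Sum>\<sigma>\<in>singular_vals A. real (sv_multiplicity A \<sigma>) * \<sigma>)"

definition op_norm :: "real ^ 'p ^ 'k \<Rightarrow> real" where
  "op_norm A = Max (singular_vals A)"

lemma inner_gram: "((transpose A ** A) *v v) \<bullet> w = (A *v v) \<bullet> (A *v w)"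
  for A :: "real ^ 'p ^ 'k"
  by (simp add: dot_lmul_matrix flip: matrix_vector_mul_assoc)

lemma finite_singular_vals: "finite (singular_vals A)"
  for A :: "real ^ 'p ^ 'k"
proof -
  define f where "f \<sigma> = (SOME v. v \<noteq> 0 \<and> (transpose A ** A) *v v = \<sigma>\<^sup>2 *\<^sub>R v)" for \<sigma>
  have f: "f \<sigma> \<noteq> 0 \<and> (transpose A ** A) *v f \<sigma> = \<sigma>\<^sup>2 *\<^sub>R f \<sigma>"
    if "\<sigma> \<in> singular_vals A" for \<sigma>
    unfolding f_def by (rule someI_ex) (use that in \<open>simp add: singular_vals_def\<close>)
  have orth: "f \<sigma> \<bullet> f \<tau> = 0"
    if "\<sigma> \<in> singular_vals A" "\<tau> \<in> singular_vals A" "\<sigma> \<noteq> \<tau>" for \<sigma> \<tau>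
  proof -
    have "\<sigma>\<^sup>2 * (f \<sigma> \<bullet> f \<tau>) = \<tau>\<^sup>2 * (f \<sigma> \<bullet> f \<tau>)"
      using inner_gram[of A "f \<sigma>" "f \<tau>"] inner_gram[of A "f \<tau>" "f \<sigma>"] f[OF that(1)] f[OF that(2)]
      by (simp add: inner_commute)
    moreover have "\<sigma>\<^sup>2 \<noteq> \<tau>\<^sup>2"
      using that by (auto simp: singular_vals_def)
    ultimately show ?thesis by simp
  qed
  have inj: "inj_on f (singular_vals A)"
  proof (rule inj_onI, rule ccontr)
    fix \<sigma> \<tau>
    assume *: "\<sigma> \<in> singular_vals A" "\<tau> \<in> singular_vals A" "f \<sigma> = f \<tau>" "\<sigma> \<noteq> \<tau>"
    from orth[OF *(1,2,4)] *(3) have "f \<tau> = 0" by simp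
    with f[OF *(2)] show False by simp
  qed
  have "pairwise orthogonal (f ` singular_vals A)"
    unfolding pairwise_def orthogonal_def using orth by blast
  then have "independent (f ` singular_vals A)"
    using f by (intro pairwise_orthogonal_independent) auto
  then have "finite (f ` singular_vals A)"
    using independent_bound by blast
  then show ?thesis
    using inj by (rule finite_imageD)
qed

lemma singular_vals_nonempty: "singular_vals A \<noteq> {}"
  for A :: "real ^ 'p ^ 'k"
proof -
  have "continuous_on (sphere 0 1) (\<lambda>v. norm (A *v v))"
    by (intro continuous_intros matrix_vector_mult_linear_continuous_on)
  moreover have "sphere (0 :: real ^ 'p) 1 \<noteq> {}"
    by (simp add: sphere_eq_empty)
  ultimately obtain v where v: "norm v = 1" and mx: "\<And>w. norm w = 1 \<Longrightarrow> norm (A *v w) \<le> norm (A *v v)"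
    using continuous_attains_sup[of "sphere (0 :: real ^ 'p) 1" "\<lambda>v. norm (A *v v)"] by auto
  define m where "m = norm (A *v v)"
  have bound: "norm (A *v w) \<le> m * norm w" for w
  proof (cases "w = 0")
    case False
    then have "norm (A *v (inverse (norm w) *\<^sub>R w)) \<le> m"
      unfolding m_def by (intro mx) simp
    then have "inverse (norm w) * norm (A *v w) \<le> m"
      by (simp add: matrix_vector_mult_scaleR)
    with False show ?thesis by (simp add: field_simps)
  qed simp
  have stat: "m\<^sup>2 * (v \<bullet> w) - (A *v v) \<bullet> (A *v w) = 0" (is "?b = 0") for w
  proof -
    define c where "c = m\<^sup>2 * (w \<bullet> w) - (A *v w) \<bullet> (A *v w)"
    have q: "0 \<le> 2 * t * ?b + t\<^sup>2 * c" for t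
    proof -
      have "(norm (A *v (v + t *\<^sub>R w)))\<^sup>2 \<le> (m * norm (v + t *\<^sub>R w))\<^sup>2"
        by (intro power_mono bound) simp
      moreover have "m\<^sup>2 * (v \<bullet> v) = (A *v v) \<bullet> (A *v v)"
        using v by (simp add: m_def flip: power2_norm_eq_inner)
      ultimately show ?thesis
        unfolding power_mult_distrib power2_norm_eq_inner c_def
        by (simp add: matrix_vector_right_distrib matrix_vector_mult_scaleR inner_add_left
            inner_add_right inner_commute algebra_simps power2_eq_square)
    qed
    have c: "0 \<le> c" using power_mono[OF bound[of w], of 2]
      unfolding power_mult_distrib power2_norm_eq_inner c_def by simp
    define t where "t = - ?b / (c + 1)"
    have "?b = - (t * (c + 1))" using c by (simp add: t_def)
    then have "2 * t * ?b + t\<^sup>2 * c = 2 * t * (- (t * (c + 1))) + t\<^sup>2 * c" by (rule arg_cong)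
    also have "\<dots> = - (t\<^sup>2 * (c + 2))" by (simp add: power2_eq_square algebra_simps)
    finally have "0 \<le> - (t\<^sup>2 * (c + 2))"
      using q[of t] by simp
    then have "t\<^sup>2 * (c + 2) \<le> 0" by simp
    then have "t = 0" using c by (simp add: mult_le_0_iff)
    then show ?thesis using c by (simp add: t_def)
  qed
  have "(transpose A ** A) *v v - m\<^sup>2 *\<^sub>R v = 0"
  proof -
    have "((transpose A ** A) *v v - m\<^sup>2 *\<^sub>R v) \<bullet> w = 0" for w
      using stat[of w] by (simp add: inner_diff_left inner_gram)
    then show ?thesis by (metis inner_eq_zero_iff)
  qed
  moreover have "v \<noteq> 0" "m \<ge> 0" using v by (auto simp: m_def)
  ultimately show ?thesis by (auto simp: singular_vals_def)
qed


section \<open>Singular value decompositions\<close>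

definition outer :: "real ^ 'k \<Rightarrow> real ^ 'p \<Rightarrow> real ^ 'p ^ 'k" where
  "outer x y = (\<chi> i j. x $ i * y $ j)"

definition orthonormal_family :: "nat \<Rightarrow> (nat \<Rightarrow> 'a :: real_inner) \<Rightarrow> bool" where
  "orthonormal_family n u \<longleftrightarrow> (\<forall>i<n. \<forall>j<n. u i \<bullet> u j = (if i = j then 1 else 0))"

text \<open>
  The columns of an orthogonal factor are given as a family of vectors indexed from \<open>0\<close>, so that
  the first \<open>r\<close> members of \<open>u\<close> and \<open>v\<close> are the columns of \<open>U\<^sup>r\<close> and \<open>V\<^sup>r\<close>.
\<close>

definition is_svd ::
  "real ^ 'p ^ 'k \<Rightarrow> (nat \<Rightarrow> real ^ 'k) \<Rightarrow> (nat \<Rightarrow> real) \<Rightarrow> (nat \<Rightarrow> real ^ 'p) \<Rightarrow> bool" where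
  "is_svd A u s v \<longleftrightarrow>
     (let m = min CARD('k) CARD('p) in
        orthonormal_family m u \<and> orthonormal_family m v \<and>
        (\<forall>i<m. s i \<ge> 0) \<and> (\<forall>i j. i \<le> j \<and> j < m \<longrightarrow> s j \<le> s i) \<and>
        A = (\<Sum>i<m. s i *\<^sub>R outer (u i) (v i)))"


section \<open>The subspace \<open>\<M>\<^sup>\<bottom>(U, V)\<close> and its projection\<close>

definition M_perp :: "nat \<Rightarrow> (nat \<Rightarrow> real ^ 'k) \<Rightarrow> (nat \<Rightarrow> real ^ 'p) \<Rightarrow> (real ^ 'p ^ 'k) set" where
  "M_perp r u v =
     {\<Theta>. (\<forall>x\<in>span (rows \<Theta>). \<forall>y\<in>span (v ` {..<r}). orthogonal x y) \<and>
          (\<forall>x\<in>span (columns \<Theta>). \<forall>y\<in>span (u ` {..<r}). orthogonal x y)}"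

text \<open>The matrix \<open>I - UU\<^sup>T\<close>.\<close>

definition compl_proj :: "nat \<Rightarrow> (nat \<Rightarrow> real ^ 'n) \<Rightarrow> real ^ 'n ^ 'n" where
  "compl_proj r u = mat 1 - (\<Sum>i<r. outer (u i) (u i))"

definition proj_M_perp ::
  "nat \<Rightarrow> (nat \<Rightarrow> real ^ 'k) \<Rightarrow> (nat \<Rightarrow> real ^ 'p) \<Rightarrow> real ^ 'p ^ 'k \<Rightarrow> real ^ 'p ^ 'k" where
  "proj_M_perp r u v \<Theta> = compl_proj r u ** \<Theta> ** compl_proj r v"

lemma outer_mult_vec: "outer x y *v z = (y \<bullet> z) *\<^sub>R x"
  by (simp add: outer_def matrix_vector_mult_def vec_eq_iff inner_vec_def sum_distrib_left
      mult_ac)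

lemma sum_mult_vec: "(\<Sum>i\<in>I. B i) *v z = (\<Sum>i\<in>I. B i *v z)"
  for B :: "'i \<Rightarrow> real ^ 'n ^ 'm"
  by (induction I rule: infinite_finite_induct) (auto simp: matrix_vector_mult_add_rdistrib)

lemma compl_proj_mult_vec: "compl_proj r u *v z = z - (\<Sum>i<r. (u i \<bullet> z) *\<^sub>R u i)"
  by (simp add: compl_proj_def matrix_vector_mult_diff_rdistrib sum_mult_vec outer_mult_vec)

lemma transpose_compl_proj: "transpose (compl_proj r u) = compl_proj r u"
  by (simp add: compl_proj_def transpose_def vec_eq_iff mat_def outer_def mult_ac)

lemma mem_M_perp_iff:
  "\<Theta> \<in> M_perp r u v \<longleftrightarrow> (\<forall>i<r. \<Theta> *v v i = 0) \<and> (\<forall>i<r. transpose \<Theta> *v u i = 0)"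
proof -
  have span: "(\<forall>x\<in>span S. \<forall>y\<in>span T. orthogonal x y) \<longleftrightarrow> (\<forall>x\<in>S. \<forall>y\<in>T. orthogonal x y)"
    for S T :: "(real ^ 'n) set"
    by (meson orthogonal_commute orthogonal_to_span span_base)
  have rows: "(\<forall>x\<in>rows A. \<forall>y\<in>w ` {..<r}. orthogonal x y) \<longleftrightarrow> (\<forall>i<r. A *v w i = 0)"
    for A :: "real ^ 'n ^ 'm" and w
  proof -
    have "rows A = range (($) A)"
      by (auto simp: rows_def row_def vec_lambda_eta)
    then show ?thesis
      by (auto simp: orthogonal_def matrix_mult_dot vec_eq_iff)
  qed
  show ?thesis
    unfolding M_perp_def mem_Collect_eq span rows
    using rows[of "transpose \<Theta>" u] by (simp add: rows_transpose)
qed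

lemma inner_matrix_mult_left: "(A ** B) \<bullet> C = B \<bullet> (transpose A ** C)"
  for A :: "real ^ 'm ^ 'k" and B :: "real ^ 'p ^ 'm"
proof -
  have "(A ** B) \<bullet> C = (\<Sum>i\<in>UNIV. \<Sum>j\<in>UNIV. \<Sum>l\<in>UNIV. A $ i $ l * B $ l $ j * C $ i $ j)"
    by (simp add: inner_vec_def matrix_matrix_mult_def sum_distrib_right)
  also have "\<dots> = (\<Sum>i\<in>UNIV. \<Sum>l\<in>UNIV. \<Sum>j\<in>UNIV. A $ i $ l * B $ l $ j * C $ i $ j)"
    by (intro sum.cong refl sum.swap)
  also have "\<dots> = (\<Sum>l\<in>UNIV. \<Sum>i\<in>UNIV. \<Sum>j\<in>UNIV. A $ i $ l * B $ l $ j * C $ i $ j)"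
    by (rule sum.swap)
  also have "\<dots> = (\<Sum>l\<in>UNIV. \<Sum>j\<in>UNIV. \<Sum>i\<in>UNIV. A $ i $ l * B $ l $ j * C $ i $ j)"
    by (intro sum.cong refl sum.swap)
  also have "\<dots> = B \<bullet> (transpose A ** C)"
    by (simp add: inner_vec_def matrix_matrix_mult_def transpose_def sum_distrib_left mult_ac)
  finally show ?thesis .
qed

lemma inner_transpose: "transpose A \<bullet> transpose B = A \<bullet> B" for A :: "real ^ 'p ^ 'k"
  by (simp add: inner_vec_def transpose_def) (rule sum.swap)

lemma inner_matrix_mult_right: "(A ** B) \<bullet> C = A \<bullet> (C ** transpose B)"
  for A :: "real ^ 'm ^ 'k" and B :: "real ^ 'p ^ 'm"
  using inner_matrix_mult_left[of "transpose B" "transpose A" "transpose C"]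
    inner_transpose[of "A ** B" C] inner_transpose[of A "C ** transpose B"]
  by (simp add: matrix_transpose_mul)

lemma compl_proj_mult_orthogonal:
  assumes "\<forall>i<r. transpose Z *v u i = 0"
  shows "compl_proj r u ** Z = Z"
proof -
  have "compl_proj r u *v (Z *v x) = Z *v x" for x
  proof -
    have "u i \<bullet> (Z *v x) = 0" if "i < r" for i
      using assms that by (metis dot_lmul_matrix inner_zero_left transpose_matrix_vector)
    then show ?thesis by (simp add: compl_proj_mult_vec)
  qed
  then show ?thesis by (simp add: matrix_eq flip: matrix_vector_mul_assoc)
qed

text \<open>\<^const>\<open>proj_M_perp\<close> is the orthogonal projection onto \<^const>\<open>M_perp\<close>.\<close>

lemma proj_M_perp_in:
  assumes "orthonormal_family r u" "orthonormal_family r v"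
  shows "proj_M_perp r u v \<Theta> \<in> M_perp r u v"
proof -
  have kill: "compl_proj r w *v w i = 0" if "orthonormal_family r w" "i < r"
    for w :: "nat \<Rightarrow> real ^ 'n" and i
  proof -
    have "(\<Sum>j<r. (w j \<bullet> w i) *\<^sub>R w j) = (\<Sum>j<r. if j = i then w i else 0)"
      using that by (intro sum.cong) (auto simp: orthonormal_family_def)
    then show ?thesis using that by (simp add: compl_proj_mult_vec)
  qed
  show ?thesis
    using assms
    by (simp add: mem_M_perp_iff proj_M_perp_def matrix_transpose_mul transpose_compl_proj kill
        flip: matrix_vector_mul_assoc)
qed

lemma proj_M_perp_orthogonal:
  assumes "Z \<in> M_perp r u v"
  shows "(\<Theta> - proj_M_perp r u v \<Theta>) \<bullet> Z = 0"
proof -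
  have 1: "compl_proj r u ** Z = Z" and "compl_proj r v ** transpose Z = transpose Z"
    using assms by (auto simp: mem_M_perp_iff compl_proj_mult_orthogonal)
  then have 2: "Z ** compl_proj r v = Z"
    by (metis matrix_transpose_mul transpose_compl_proj transpose_transpose)
  have "proj_M_perp r u v \<Theta> \<bullet> Z = \<Theta> \<bullet> Z"
    using inner_matrix_mult_right[of "compl_proj r u ** \<Theta>" "compl_proj r v" Z]
      inner_matrix_mult_left[of "compl_proj r u" \<Theta> Z]
    by (simp add: proj_M_perp_def transpose_compl_proj 1 2)
  then show ?thesis by (simp add: inner_diff_left)
qed


section \<open>Observation operator and restricted strong convexity\<close>

text \<open>The sample size \<open>N\<close> is \<^term>\<open>CARD('n)\<close>.\<close>

definition obs_op :: "('n::finite \<Rightarrow> real ^ 'p ^ 'k) \<Rightarrow> real ^ 'p ^ 'k \<Rightarrow> real ^ 'n" where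
  "obs_op X \<Theta> = (\<chi> i. trace (transpose (X i) ** \<Theta>))"

definition obs_adjoint :: "('n::finite \<Rightarrow> real ^ 'p ^ 'k) \<Rightarrow> real ^ 'n \<Rightarrow> real ^ 'p ^ 'k" where
  "obs_adjoint X \<epsilon> = (\<Sum>i\<in>UNIV. \<epsilon> $ i *\<^sub>R X i)"

definition error_set ::
  "real ^ 'p ^ 'k \<Rightarrow> (nat \<Rightarrow> real ^ 'k) \<Rightarrow> (nat \<Rightarrow> real ^ 'p) \<Rightarrow> nat \<Rightarrow> real
     \<Rightarrow> (real ^ 'p ^ 'k) set" where
  "error_set \<Theta>s u v r \<delta> =
     {\<Delta>. norm \<Delta> \<ge> \<delta> \<and>
          nuclear_norm (proj_M_perp r u v \<Delta>)
            \<le> 3 * nuclear_norm (\<Delta> - proj_M_perp r u v \<Delta>)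
              + 4 * nuclear_norm (proj_M_perp r u v \<Theta>s)}"

definition restricted_strong_convexity ::
  "('n::finite \<Rightarrow> real ^ 'p ^ 'k) \<Rightarrow> real \<Rightarrow> (real ^ 'p ^ 'k) set \<Rightarrow> bool" where
  "restricted_strong_convexity X \<kappa> C \<longleftrightarrow>
     \<kappa> > 0 \<and>
     (\<forall>\<Delta>\<in>C. 1 / (2 * real CARD('n)) * (norm (obs_op X \<Delta>))\<^sup>2 \<ge> \<kappa> * (norm \<Delta>)\<^sup>2)"

definition nuclear_objective ::
  "('n::finite \<Rightarrow> real ^ 'p ^ 'k) \<Rightarrow> real ^ 'n \<Rightarrow> real \<Rightarrow> real ^ 'p ^ 'k \<Rightarrow> real" where
  "nuclear_objective X y lam \<Theta> =
     1 / (2 * real CARD('n)) * (norm (y - obs_op X \<Theta>))\<^sup>2 + lam * nuclear_norm \<Theta>"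

end

theory Submission
  imports Defs
begin

text \<open>
  Write \<open>\<Delta> = \<Theta>hat - \<Theta>s\<close> and let \<open>\<Delta>'' = \<Pi>(\<Delta>)\<close> be its projection onto \<open>\<M>\<^sup>\<bottom>\<close>, \<open>\<Delta>' = \<Delta> - \<Delta>''\<close> and
  \<open>B = \<Pi>(\<Theta>s)\<close>. Comparing the objective at \<open>\<Theta>hat\<close> and at \<open>\<Theta>s\<close> gives
  \<open>\<parallel>X(\<Delta>)\<parallel>\<^sup>2 / 2N \<le> \<langle>X\<^sup>*(\<epsilon>), \<Delta>\<rangle> / N + lam (\<parallel>\<Theta>s\<parallel>\<^sub>1 - \<parallel>\<Theta>hat\<parallel>\<^sub>1)\<close>.
  Duality of the nuclear and the operator norm together with the choice of \<open>lam\<close> bounds the noise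
  term by \<open>lam \<parallel>\<Delta>\<parallel>\<^sub>1 / 2\<close>. The nuclear norm is decomposable: \<open>\<Theta>s - B\<close> is the leading part of the
  singular value decomposition, whose row and column spaces are orthogonal to those of \<open>\<Delta>''\<close>, so
  the norms of \<open>\<Theta>s - B\<close> and \<open>\<Delta>''\<close> add up, and the regularisation term is at most
  \<open>lam (2\<parallel>B\<parallel>\<^sub>1 + \<parallel>\<Delta>'\<parallel>\<^sub>1 - \<parallel>\<Delta>''\<parallel>\<^sub>1)\<close>. Altogether
  \<open>0 \<le> \<parallel>X(\<Delta>)\<parallel>\<^sup>2 / 2N \<le> lam (2\<parallel>B\<parallel>\<^sub>1 + 3/2 \<parallel>\<Delta>'\<parallel>\<^sub>1 - 1/2 \<parallel>\<Delta>''\<parallel>\<^sub>1)\<close>.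

  Nonnegativity of the right-hand side is precisely the cone condition of \<^const>\<open>error_set\<close>. Hence, unless
  \<open>\<parallel>\<Delta>\<parallel> < \<delta>\<close>, strong convexity applies and bounds the middle from below by \<open>\<kappa>\<parallel>\<Delta>\<parallel>\<^sup>2\<close>. Since \<open>\<Delta>'\<close> is a sum
  of two matrices of rank at most \<open>r\<close>, its nuclear norm is at most \<open>2\<surd>r \<parallel>\<Delta>\<parallel>\<close>, and
  \<open>\<kappa>\<parallel>\<Delta>\<parallel>\<^sup>2 \<le> lam (2\<parallel>B\<parallel>\<^sub>1 + 3\<surd>r \<parallel>\<Delta>\<parallel>)\<close>; if \<open>\<parallel>\<Delta>\<parallel>\<close> exceeded all three bounds, the right-hand side would
  be at most \<open>7/32 \<kappa>\<parallel>\<Delta>\<parallel>\<^sup>2\<close>.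

  Everything about the nuclear norm rests on \<open>singular_basis\<close>, which turns the sum over eigenvalues
  of \<open>A\<^sup>TA\<close> with multiplicity into \<open>\<Sum>b\<in>B. \<parallel>A b\<parallel>\<close> for an orthonormal basis \<open>B\<close> with orthogonal images.
  From it follows that \<open>\<parallel>A\<parallel>\<^sub>1\<close> is the largest value of \<open>W \<bullet> A\<close> over contractions \<open>W\<close>
  (\<open>contraction_inner_le\<close>, \<open>nuclear_norm_attained\<close>). The triangle inequality, decomposability
  (\<open>nuclear_norm_decomposable\<close>) and the rank bound (\<open>nuclear_norm_minus_proj_le\<close>) all use this
  variational description, so that a given singular value decomposition never has to be compared
  with the eigenbasis behind the nuclear norm.
\<close>

section \<open>An orthonormal basis of singular vectors\<close>

text \<open>
  A unit vector maximising \<open>\<parallel>A v\<parallel>\<close> within \<open>S\<close> is an eigenvector: the residual \<open>m\<^sup>2v - A\<^sup>TA v\<close> lies in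
  \<open>S\<close> by invariance, and moving \<open>v\<close> along it would otherwise increase the ratio \<open>\<parallel>A v\<parallel> / \<parallel>v\<parallel>\<close>.
\<close>

lemma invariant_subspace_eigenvector:
  fixes A :: "real ^ 'p ^ 'k"
  assumes S: "subspace S" "S \<noteq> {0}"
    and inv: "\<And>x. x \<in> S \<Longrightarrow> (transpose A ** A) *v x \<in> S"
  obtains v \<sigma> where "v \<in> S" "v \<noteq> 0" "\<sigma> \<ge> 0" "(transpose A ** A) *v v = \<sigma>\<^sup>2 *\<^sub>R v"
proof -
  let ?K = "S \<inter> sphere 0 1"
  obtain x where x: "x \<in> S" "x \<noteq> 0"
    using S subspace_0 by blast
  have "inverse (norm x) *\<^sub>R x \<in> ?K"
    using x S by (simp add: subspace_scale)
  then have "?K \<noteq> {}" by blast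
  moreover have "compact ?K"
    using closed_subspace[OF S(1)] by (simp add: closed_Int_compact)
  moreover have "continuous_on ?K (\<lambda>v. norm (A *v v))"
    by (intro continuous_intros matrix_vector_mult_linear_continuous_on)
  ultimately obtain v where "v \<in> ?K" "\<forall>w\<in>?K. norm (A *v w) \<le> norm (A *v v)"
    using continuous_attains_sup[of ?K "\<lambda>v. norm (A *v v)"] by blast
  then have v: "v \<in> S" "norm v = 1"
    and mx: "\<And>w. w \<in> S \<Longrightarrow> norm w = 1 \<Longrightarrow> norm (A *v w) \<le> norm (A *v v)"
    by auto
  define m where "m = norm (A *v v)"
  have bound: "norm (A *v w) \<le> m * norm w" if "w \<in> S" for w
  proof (cases "w = 0")
    case False
    with that S have "norm (A *v (inverse (norm w) *\<^sub>R w)) \<le> m"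
      unfolding m_def by (intro mx) (auto simp: subspace_scale)
    with False show ?thesis
      by (simp add: matrix_vector_mult_scaleR field_simps)
  qed simp
  define g where "g = m\<^sup>2 *\<^sub>R v - (transpose A ** A) *v v"
  have g: "g \<in> S"
    unfolding g_def using v S inv by (intro subspace_diff subspace_scale)
  define c where "c = m\<^sup>2 * (g \<bullet> g) - (A *v g) \<bullet> (A *v g)"
  have gg: "g \<bullet> g = m\<^sup>2 * (v \<bullet> g) - (A *v v) \<bullet> (A *v g)"
    by (subst (1) g_def) (simp add: inner_diff_left inner_gram)
  \<comment> \<open>The form \<open>m\<^sup>2\<parallel>w\<parallel>\<^sup>2 - \<parallel>A w\<parallel>\<^sup>2\<close> is nonnegative on \<open>S\<close> and vanishes at \<open>v\<close>; \<open>g\<close> is half its gradient there.\<close>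
  have q: "0 \<le> 2 * t * (g \<bullet> g) + t\<^sup>2 * c" for t
  proof -
    have "(norm (A *v (v + t *\<^sub>R g)))\<^sup>2 \<le> (m * norm (v + t *\<^sub>R g))\<^sup>2"
      using v g S by (intro power_mono bound) (auto intro: subspace_add subspace_scale)
    moreover have "m\<^sup>2 * (v \<bullet> v) = (A *v v) \<bullet> (A *v v)"
      using v by (simp add: m_def flip: power2_norm_eq_inner)
    ultimately have "0 \<le> 2 * t * (m\<^sup>2 * (v \<bullet> g) - (A *v v) \<bullet> (A *v g)) + t\<^sup>2 * c"
      unfolding power_mult_distrib power2_norm_eq_inner c_def
      by (simp add: matrix_vector_right_distrib matrix_vector_mult_scaleR inner_add_left
          inner_add_right inner_commute algebra_simps power2_eq_square)
    then show ?thesis by (simp only: gg)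
  qed
  \<comment> \<open>Take a step of length \<open>t\<close> against the gradient and divide by \<open>t\<close>; small \<open>t\<close> then force \<open>g = 0\<close>.\<close>
  have lin: "2 * (g \<bullet> g) \<le> t * c" if "t > 0" for t
  proof -
    have "0 \<le> t * (t * c - 2 * (g \<bullet> g))"
      using q[of "- t"] by (simp add: algebra_simps power2_eq_square)
    then show ?thesis using that by (simp add: zero_le_mult_iff)
  qed
  have "g \<bullet> g \<le> 0"
  proof (cases "c > 0")
    case True
    then show ?thesis using lin[of "(g \<bullet> g) / c"] by (cases "g \<bullet> g > 0") auto
  next
    case False
    then show ?thesis using lin[of 1] by simp
  qed
  then have "g = 0" by (metis inner_eq_zero_iff inner_ge_zero order_antisym)
  then have "(transpose A ** A) *v v = m\<^sup>2 *\<^sub>R v" by (simp add: g_def)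
  moreover have "v \<noteq> 0" "m \<ge> 0" using v by (auto simp: m_def)
  ultimately show ?thesis using that v by blast
qed

definition orthonormal_basis :: "(real ^ 'n) set \<Rightarrow> bool" where
  "orthonormal_basis B \<longleftrightarrow>
     finite B \<and> pairwise orthogonal B \<and> (\<forall>b\<in>B. norm b = 1) \<and> span B = UNIV"

lemma orthonormal_basis_inner:
  assumes "orthonormal_basis B"
  shows "x \<bullet> y = (\<Sum>b\<in>B. (x \<bullet> b) * (y \<bullet> b))"
proof -
  have "x \<bullet> y = (\<Sum>b\<in>B. (x \<bullet> b) *\<^sub>R b) \<bullet> y"
    using assms by (subst orthonormal_basis_expand) (auto simp: orthonormal_basis_def)
  also have "\<dots> = (\<Sum>b\<in>B. (x \<bullet> b) * (y \<bullet> b))"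
    by (simp add: inner_sum_left inner_commute[of y])
  finally show ?thesis .
qed

text \<open>\<open>W \<bullet> A\<close> is the trace of \<open>W\<^sup>TA\<close>, which does not depend on the orthonormal basis.\<close>

lemma matrix_inner_orthonormal_basis:
  fixes W A :: "real ^ 'p ^ 'k"
  assumes "orthonormal_basis B"
  shows "W \<bullet> A = (\<Sum>b\<in>B. (W *v b) \<bullet> (A *v b))"
proof -
  have "W \<bullet> A = (\<Sum>i\<in>UNIV. \<Sum>b\<in>B. (W $ i \<bullet> b) * (A $ i \<bullet> b))"
    unfolding inner_vec_def[of W A]
    by (intro sum.cong refl orthonormal_basis_inner[OF assms])
  also have "\<dots> = (\<Sum>b\<in>B. \<Sum>i\<in>UNIV. (W $ i \<bullet> b) * (A $ i \<bullet> b))"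
    by (rule sum.swap)
  also have "\<dots> = (\<Sum>b\<in>B. (W *v b) \<bullet> (A *v b))"
    by (simp add: inner_vec_def[of "W *v _"] matrix_vector_mul_component)
  finally show ?thesis .
qed

text \<open>
  The spectral theorem for \<open>A\<^sup>TA\<close>. The union of orthonormal bases of the eigenspaces is orthonormal;
  it spans because its orthogonal complement is invariant under \<open>A\<^sup>TA\<close> and would otherwise contain
  a further eigenvector. Each \<open>\<sigma>\<close> occurs as \<open>\<parallel>A b\<parallel>\<close> as often as its multiplicity says.
\<close>

lemma singular_basis:
  fixes A :: "real ^ 'p ^ 'k"
  obtains B where "orthonormal_basis B"
    "pairwise (\<lambda>b c. orthogonal (A *v b) (A *v c)) B"
    "\<And>b. b \<in> B \<Longrightarrow> norm (A *v b) \<in> singular_vals A"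
    "nuclear_norm A = (\<Sum>b\<in>B. norm (A *v b))"
proof -
  let ?G = "transpose A ** A" and ?S = "singular_vals A"
  define E where "E \<sigma> = {v. ?G *v v = \<sigma>\<^sup>2 *\<^sub>R v}" for \<sigma> :: real
  have sub: "subspace (E \<sigma>)" for \<sigma>
    by (auto simp: E_def subspace_def matrix_vector_right_distrib matrix_vector_mult_scaleR
        scaleR_add_right)
  have "\<exists>B. B \<subseteq> E \<sigma> \<and> pairwise orthogonal B \<and> (\<forall>x\<in>B. norm x = 1) \<and> independent B \<and>
      card B = dim (E \<sigma>) \<and> span B = E \<sigma>" for \<sigma>
    using orthonormal_basis_subspace[OF sub] by metis
  then obtain F where F: "\<And>\<sigma>. F \<sigma> \<subseteq> E \<sigma>" "\<And>\<sigma>. pairwise orthogonal (F \<sigma>)"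
    "\<And>\<sigma> x. x \<in> F \<sigma> \<Longrightarrow> norm x = 1" "\<And>\<sigma>. independent (F \<sigma>)"
    "\<And>\<sigma>. card (F \<sigma>) = dim (E \<sigma>)" "\<And>\<sigma>. span (F \<sigma>) = E \<sigma>"
    by metis
  have fin: "finite (F \<sigma>)" for \<sigma> using F(4) independent_imp_finite by blast
  define B where "B = (\<Union>\<sigma>\<in>?S. F \<sigma>)"
  have eig: "?G *v b = \<sigma>\<^sup>2 *\<^sub>R b" if "b \<in> F \<sigma>" for b \<sigma>
    using F(1) that by (auto simp: E_def)
  have orth: "b \<bullet> c = 0" if "b \<in> F \<sigma>" "c \<in> F \<tau>" "\<sigma> \<in> ?S" "\<tau> \<in> ?S" "\<sigma> \<noteq> \<tau>" for b c \<sigma> \<tau>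
  proof -
    have "\<sigma>\<^sup>2 * (b \<bullet> c) = \<tau>\<^sup>2 * (b \<bullet> c)"
      using inner_gram[of A b c] inner_gram[of A c b] eig[OF that(1)] eig[OF that(2)]
      by (simp add: inner_commute)
    moreover have "\<sigma>\<^sup>2 \<noteq> \<tau>\<^sup>2"
      using that by (auto simp: singular_vals_def)
    ultimately show ?thesis by simp
  qed
  have finB: "finite B" using fin finite_singular_vals by (auto simp: B_def)
  have norm1: "norm b = 1" if "b \<in> B" for b using that F(3) by (auto simp: B_def)
  have pw: "pairwise orthogonal B"
    using orth F(2) unfolding pairwise_def orthogonal_def B_def by (metis UN_E)
  have "span B = UNIV"
  proof (rule ccontr)
    assume ne: "span B \<noteq> UNIV"
    define S where "S = {x. \<forall>b\<in>B. x \<bullet> b = 0}"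
    have "subspace S" by (auto simp: S_def subspace_def inner_add_left)
    moreover have "S \<noteq> {0}"
    proof -
      have "dim B < DIM(real ^ 'p)"
        using ne dim_eq_full dim_subset_UNIV[of B] by (metis le_neq_implies_less)
      then obtain x where "x \<noteq> 0" "\<And>y. y \<in> span B \<Longrightarrow> orthogonal x y"
        using orthogonal_to_subspace_exists by blast
      then show ?thesis by (auto simp: S_def orthogonal_def span_base)
    qed
    moreover have "?G *v x \<in> S" if "x \<in> S" for x
    proof -
      have "(?G *v x) \<bullet> b = 0" if "b \<in> B" for b
      proof -
        obtain \<sigma> where "b \<in> F \<sigma>" using \<open>b \<in> B\<close> by (auto simp: B_def)
        moreover have "(?G *v x) \<bullet> b = (?G *v b) \<bullet> x"
          by (metis inner_gram inner_commute)
        ultimately show ?thesis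
          using eig \<open>x \<in> S\<close> \<open>b \<in> B\<close> by (auto simp: S_def inner_commute)
      qed
      then show ?thesis by (simp add: S_def)
    qed
    ultimately obtain v \<sigma> where v: "v \<in> S" "v \<noteq> 0" "\<sigma> \<ge> 0" "?G *v v = \<sigma>\<^sup>2 *\<^sub>R v"
      by (rule invariant_subspace_eigenvector)
    then have "\<sigma> \<in> ?S" by (auto simp: singular_vals_def)
    then have "F \<sigma> \<subseteq> B" by (auto simp: B_def)
    moreover have "v \<in> span (F \<sigma>)" using v F(6) by (simp add: E_def)
    moreover have "\<And>b. b \<in> B \<Longrightarrow> orthogonal v b"
      using v(1) by (auto simp: S_def orthogonal_def)
    ultimately have "orthogonal v v"
      by (meson orthogonal_to_span subsetD)
    with v show False by (simp add: orthogonal_self)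
  qed
  with pw norm1 finB have onb: "orthonormal_basis B" by (simp add: orthonormal_basis_def)
  have normA: "norm (A *v b) = \<sigma>" if "b \<in> F \<sigma>" "\<sigma> \<in> ?S" for b \<sigma>
  proof -
    have "(norm (A *v b))\<^sup>2 = \<sigma>\<^sup>2 * (norm b)\<^sup>2"
      using inner_gram[of A b b] eig[OF that(1)] by (simp add: power2_norm_eq_inner)
    then show ?thesis
      using that F(3)[OF that(1)] by (simp add: singular_vals_def power2_eq_iff_nonneg)
  qed
  have pwA: "pairwise (\<lambda>b c. orthogonal (A *v b) (A *v c)) B"
  proof (rule pairwiseI)
    fix b c assume bc: "b \<in> B" "c \<in> B" "b \<noteq> c"
    then obtain \<sigma> where "b \<in> F \<sigma>" by (auto simp: B_def)
    with bc pw show "orthogonal (A *v b) (A *v c)"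
      using inner_gram[of A b c] eig by (auto simp: orthogonal_def pairwise_def)
  qed
  have "(\<Sum>b\<in>B. norm (A *v b)) = (\<Sum>\<sigma>\<in>?S. \<Sum>b\<in>F \<sigma>. norm (A *v b))"
    unfolding B_def
  proof (rule sum.UNION_disjoint)
    show "\<forall>\<sigma>\<in>?S. \<forall>\<tau>\<in>?S. \<sigma> \<noteq> \<tau> \<longrightarrow> F \<sigma> \<inter> F \<tau> = {}"
    proof (intro ballI impI equals0I)
      fix \<sigma> \<tau> b assume "\<sigma> \<in> ?S" "\<tau> \<in> ?S" "\<sigma> \<noteq> \<tau>" "b \<in> F \<sigma> \<inter> F \<tau>"
      then have "b \<bullet> b = 0" "norm b = 1" using orth F(3) by blast+
      then show False by simp
    qed
  qed (use fin finite_singular_vals in auto)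
  also have "\<dots> = (\<Sum>\<sigma>\<in>?S. \<Sum>b\<in>F \<sigma>. \<sigma>)"
    using normA by (intro sum.cong refl) auto
  also have "\<dots> = nuclear_norm A"
    by (simp add: nuclear_norm_def sv_multiplicity_def F(5) E_def)
  finally have "nuclear_norm A = (\<Sum>b\<in>B. norm (A *v b))" ..
  moreover have "norm (A *v b) \<in> ?S" if "b \<in> B" for b
    using that normA by (auto simp: B_def)
  ultimately show ?thesis using that onb pwA by blast
qed

section \<open>Duality between the nuclear norm and the operator norm\<close>

text \<open>
  A singular basis has orthogonal images, so \<open>\<parallel>A x\<parallel>\<^sup>2\<close> is a combination of squared singular values
  with the weights \<open>(x \<bullet> b)\<^sup>2\<close>, which add up to \<open>\<parallel>x\<parallel>\<^sup>2\<close>.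
\<close>

lemma norm_le_op_norm: "norm (A *v x) \<le> op_norm A * norm x"
  for A :: "real ^ 'p ^ 'k"
proof -
  obtain B where B: "orthonormal_basis B"
    "pairwise (\<lambda>b c. orthogonal (A *v b) (A *v c)) B"
    "\<And>b. b \<in> B \<Longrightarrow> norm (A *v b) \<in> singular_vals A"
    using singular_basis[of A] by metis
  have nn: "op_norm A \<ge> 0"
    unfolding op_norm_def
    using Max_in[OF finite_singular_vals singular_vals_nonempty, of A]
    by (auto simp: singular_vals_def)
  have "x = (\<Sum>b\<in>B. (x \<bullet> b) *\<^sub>R b)"
    using B(1) by (subst orthonormal_basis_expand) (auto simp: orthonormal_basis_def)
  then have "A *v x = A *v (\<Sum>b\<in>B. (x \<bullet> b) *\<^sub>R b)"
    by (rule arg_cong)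
  also have "\<dots> = (\<Sum>b\<in>B. (x \<bullet> b) *\<^sub>R (A *v b))"
    by (simp add: linear_sum[OF matrix_vector_mul_linear] matrix_vector_mult_scaleR)
  finally have "(norm (A *v x))\<^sup>2 = (\<Sum>b\<in>B. (norm ((x \<bullet> b) *\<^sub>R (A *v b)))\<^sup>2)"
    using B by (simp only:, intro norm_sum_Pythagorean)
      (auto simp: orthonormal_basis_def pairwise_def orthogonal_def)
  also have "\<dots> \<le> (\<Sum>b\<in>B. (op_norm A)\<^sup>2 * ((x \<bullet> b) * (x \<bullet> b)))"
  proof (rule sum_mono)
    fix b assume "b \<in> B"
    then have "norm (A *v b) \<le> op_norm A"
      unfolding op_norm_def using B(3) finite_singular_vals by (intro Max_ge)
    then have "(norm (A *v b))\<^sup>2 * (x \<bullet> b)\<^sup>2 \<le> (op_norm A)\<^sup>2 * (x \<bullet> b)\<^sup>2"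
      by (intro mult_right_mono power_mono) auto
    then show "(norm ((x \<bullet> b) *\<^sub>R (A *v b)))\<^sup>2 \<le> (op_norm A)\<^sup>2 * ((x \<bullet> b) * (x \<bullet> b))"
      by (simp add: power_mult_distrib mult.commute flip: power2_eq_square)
  qed
  also have "\<dots> = (op_norm A * norm x)\<^sup>2"
    by (simp add: power_mult_distrib power2_norm_eq_inner orthonormal_basis_inner[OF B(1), of x x]
        sum_distrib_left)
  finally show ?thesis
    by (rule power2_le_imp_le) (simp add: nn)
qed

text \<open>
  Expand \<open>W \<bullet> A\<close> in a singular basis of \<open>A\<close> and apply Cauchy-Schwarz to each term.
\<close>

lemma inner_le_nuclear_norm:
  fixes W A :: "real ^ 'p ^ 'k"
  assumes "\<And>x. norm (W *v x) \<le> c * norm x"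
  shows "W \<bullet> A \<le> c * nuclear_norm A"
proof -
  obtain B where B: "orthonormal_basis B" "nuclear_norm A = (\<Sum>b\<in>B. norm (A *v b))"
    using singular_basis[of A] by metis
  have "W \<bullet> A = (\<Sum>b\<in>B. (W *v b) \<bullet> (A *v b))"
    by (rule matrix_inner_orthonormal_basis[OF B(1)])
  also have "\<dots> \<le> (\<Sum>b\<in>B. c * norm (A *v b))"
  proof (rule sum_mono)
    fix b assume "b \<in> B"
    then have "norm (W *v b) \<le> c" using assms[of b] B(1) by (simp add: orthonormal_basis_def)
    then show "(W *v b) \<bullet> (A *v b) \<le> c * norm (A *v b)"
      by (meson norm_cauchy_schwarz order_trans mult_right_mono norm_ge_zero)
  qed
  finally show ?thesis by (simp add: B(2) sum_distrib_left)
qed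

definition contraction :: "real ^ 'p ^ 'k \<Rightarrow> bool" where
  "contraction W \<longleftrightarrow> (\<forall>x. norm (W *v x) \<le> norm x)"

lemma contraction_inner_le: "contraction W \<Longrightarrow> W \<bullet> A \<le> nuclear_norm A"
  using inner_le_nuclear_norm[of W 1 A] by (simp add: contraction_def)

lemma outer_inner: "outer x y \<bullet> A = x \<bullet> (A *v y)"
  by (simp add: outer_def inner_vec_def matrix_vector_mult_def sum_distrib_left mult_ac)

text \<open>
  The partial isometry of the polar decomposition of \<open>A\<close> attains the bound. As \<open>sgn 0 = 0\<close>, it
  vanishes on the kernel of \<open>A\<close>.
\<close>

lemma nuclear_norm_attained:
  fixes A :: "real ^ 'p ^ 'k"
  obtains W where "contraction W" "W \<bullet> A = nuclear_norm A"
proof -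
  obtain B where B: "orthonormal_basis B"
    "pairwise (\<lambda>b c. orthogonal (A *v b) (A *v c)) B"
    "nuclear_norm A = (\<Sum>b\<in>B. norm (A *v b))"
    using singular_basis[of A] by metis
  define W where "W = (\<Sum>b\<in>B. outer (sgn (A *v b)) b)"
  have "norm (W *v x) \<le> norm x" for x
  proof (rule power2_le_imp_le)
    have "(norm (W *v x))\<^sup>2 = (\<Sum>b\<in>B. (norm ((b \<bullet> x) *\<^sub>R sgn (A *v b)))\<^sup>2)"
      unfolding W_def sum_mult_vec outer_mult_vec using B
      by (intro norm_sum_Pythagorean)
        (auto simp: orthonormal_basis_def pairwise_def orthogonal_def sgn_div_norm)
    also have "\<dots> \<le> (\<Sum>b\<in>B. (x \<bullet> b) * (x \<bullet> b))"
      by (intro sum_mono) (auto simp: norm_sgn power2_eq_square inner_commute)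
    also have "\<dots> = (norm x)\<^sup>2"
      by (simp add: power2_norm_eq_inner orthonormal_basis_inner[OF B(1), of x x])
    finally show "(norm (W *v x))\<^sup>2 \<le> (norm x)\<^sup>2" .
  qed simp
  moreover have "W \<bullet> A = nuclear_norm A"
  proof -
    have "sgn z \<bullet> z = norm z" for z :: "real ^ 'k"
      by (cases "z = 0") (simp_all add: sgn_div_norm power2_eq_square flip: power2_norm_eq_inner)
    then show ?thesis by (simp add: W_def inner_sum_left outer_inner B(3))
  qed
  ultimately show ?thesis using that unfolding contraction_def by blast
qed

text \<open>
  With the nuclear norm a maximum of linear functionals, upper bounds can be checked against one
  contraction at a time.
\<close>

lemma nuclear_norm_leI:
  assumes "\<And>W. contraction W \<Longrightarrow> W \<bullet> A \<le> c"
  shows "nuclear_norm A \<le> c"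
  using assms nuclear_norm_attained by metis

lemma nuclear_norm_nonneg: "nuclear_norm A \<ge> 0"
  by (auto simp: nuclear_norm_def singular_vals_def intro!: sum_nonneg)

lemma nuclear_norm_triangle: "nuclear_norm (A + B) \<le> nuclear_norm A + nuclear_norm B"
  by (rule nuclear_norm_leI) (simp add: inner_add_right add_mono contraction_inner_le)

lemma nuclear_norm_minus: "nuclear_norm (- A) = nuclear_norm A" for A :: "real ^ 'p ^ 'k"
proof -
  have le: "nuclear_norm (- A) \<le> nuclear_norm A" for A :: "real ^ 'p ^ 'k"
  proof (rule nuclear_norm_leI)
    fix W :: "real ^ 'p ^ 'k" assume "contraction W"
    moreover have "(- W) *v x = - (W *v x)" for x
      by (simp add: vec_eq_iff matrix_vector_mult_def sum_negf)
    ultimately have "contraction (- W)"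
      by (simp add: contraction_def)
    from contraction_inner_le[OF this, of A] show "W \<bullet> (- A) \<le> nuclear_norm A"
      by simp
  qed
  show ?thesis using le[of A] le[of "- A"] by simp
qed

text \<open>
  The nuclear norm is dominated by the cost of any representation as a sum of rank-one matrices.
  This yields every upper bound on a nuclear norm that depends on rank.
\<close>

lemma nuclear_norm_sum_outer_le:
  fixes x :: "'i \<Rightarrow> real ^ 'k" and y :: "'i \<Rightarrow> real ^ 'p"
  shows "nuclear_norm (\<Sum>i\<in>I. outer (x i) (y i)) \<le> (\<Sum>i\<in>I. norm (x i) * norm (y i))"
proof (rule nuclear_norm_leI)
  fix W :: "real ^ 'p ^ 'k" assume W: "contraction W"
  have "W \<bullet> (\<Sum>i\<in>I. outer (x i) (y i)) = (\<Sum>i\<in>I. x i \<bullet> (W *v y i))"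
    by (simp add: inner_sum_right inner_commute[of W] outer_inner)
  also have "\<dots> \<le> (\<Sum>i\<in>I. norm (x i) * norm (y i))"
    using W unfolding contraction_def
    by (intro sum_mono) (meson norm_cauchy_schwarz order_trans mult_left_mono norm_ge_zero)
  finally show "W \<bullet> (\<Sum>i\<in>I. outer (x i) (y i)) \<le> (\<Sum>i\<in>I. norm (x i) * norm (y i))" .
qed

section \<open>Decomposability\<close>

lemma norm_sum_orthonormal_family:
  assumes "orthonormal_family r u"
  shows "(norm (\<Sum>i<r. c i *\<^sub>R u i))\<^sup>2 = (\<Sum>i<r. (c i)\<^sup>2)"
proof -
  have "(norm (\<Sum>i<r. c i *\<^sub>R u i))\<^sup>2 = (\<Sum>i<r. (norm (c i *\<^sub>R u i))\<^sup>2)"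
    using assms by (intro norm_sum_Pythagorean)
      (auto simp: orthonormal_family_def pairwise_def orthogonal_def)
  also have "\<dots> = (\<Sum>i<r. (c i)\<^sup>2)"
    using assms by (intro sum.cong) (auto simp: orthonormal_family_def norm_eq_sqrt_inner)
  finally show ?thesis .
qed

lemma orthonormal_family_mono: "orthonormal_family n u \<Longrightarrow> r \<le> n \<Longrightarrow> orthonormal_family r u"
  by (auto simp: orthonormal_family_def)

lemma inner_sum_orthonormal_family:
  assumes "orthonormal_family r u" "i < r"
  shows "u i \<bullet> (\<Sum>j<r. c j *\<^sub>R u j) = c i"
proof -
  have "u i \<bullet> (\<Sum>j<r. c j *\<^sub>R u j) = (\<Sum>j<r. if i = j then c j else 0)"
    unfolding inner_sum_right using assms
    by (intro sum.cong) (auto simp: orthonormal_family_def)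
  then show ?thesis using assms by simp
qed

lemma compl_proj_orthogonal:
  "orthonormal_family r u \<Longrightarrow> i < r \<Longrightarrow> u i \<bullet> (compl_proj r u *v z) = 0"
  using inner_sum_orthonormal_family[of r u i "\<lambda>j. u j \<bullet> z"]
  by (simp add: compl_proj_mult_vec inner_diff_right)

lemma compl_proj_Pythagorean:
  assumes "orthonormal_family r u"
  shows "(norm (compl_proj r u *v z))\<^sup>2 + (\<Sum>i<r. (u i \<bullet> z)\<^sup>2) = (norm z)\<^sup>2"
proof -
  let ?s = "\<Sum>i<r. (u i \<bullet> z) *\<^sub>R u i"
  have "orthogonal (compl_proj r u *v z) ?s"
    using assms compl_proj_orthogonal
    by (intro orthogonal_rvsum) (auto simp: orthogonal_def inner_commute)
  then have "(norm (compl_proj r u *v z + ?s))\<^sup>2 = (norm (compl_proj r u *v z))\<^sup>2 + (norm ?s)\<^sup>2"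
    by (rule norm_add_Pythagorean)
  then show ?thesis
    by (simp add: norm_sum_orthonormal_family[OF assms] compl_proj_mult_vec)
qed

lemma norm_compl_proj_le:
  assumes "orthonormal_family r u"
  shows "norm (compl_proj r u *v z) \<le> norm z"
proof (rule power2_le_imp_le)
  have "0 \<le> (\<Sum>i<r. (u i \<bullet> z)\<^sup>2)" by (simp add: sum_nonneg)
  then show "(norm (compl_proj r u *v z))\<^sup>2 \<le> (norm z)\<^sup>2"
    using compl_proj_Pythagorean[OF assms, of z] by linarith
qed simp

text \<open>
  The contractions \<open>W1\<close> and \<open>W\<close> that attain the norms of \<open>A\<close> and of the projection \<open>\<Pi>(D)\<close> combine to
  one that attains both at once: sandwiching \<open>W\<close> between the complementary projections leaves its
  pairing with \<open>\<Pi>(D)\<close> unchanged and makes it act between subspaces orthogonal to those of \<open>W1\<close>, so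
  \<open>W1 + W2\<close> is a contraction by Pythagoras in the domain and in the codomain.
\<close>

lemma nuclear_norm_decomposable:
  assumes u: "orthonormal_family r u" and v: "orthonormal_family r v"
    and s: "\<And>i. i < r \<Longrightarrow> s i \<ge> 0"
  defines "A \<equiv> \<Sum>i<r. s i *\<^sub>R outer (u i) (v i)"
  shows "nuclear_norm A + nuclear_norm (proj_M_perp r u v D)
    \<le> nuclear_norm (A + proj_M_perp r u v D)"
proof -
  let ?P = "compl_proj r u" and ?Q = "compl_proj r v"
  obtain W where W: "contraction W" "W \<bullet> proj_M_perp r u v D = nuclear_norm (proj_M_perp r u v D)"
    by (rule nuclear_norm_attained)
  define W1 where "W1 = (\<Sum>i<r. outer (u i) (v i))"
  define W2 where "W2 = ?P ** W ** ?Q"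
  have W1x: "W1 *v x = (\<Sum>i<r. (v i \<bullet> x) *\<^sub>R u i)" for x
    by (simp add: W1_def sum_mult_vec outer_mult_vec)
  have W2x: "W2 *v x = ?P *v (W *v (?Q *v x))" for x
    by (simp add: W2_def matrix_vector_mul_assoc matrix_mul_assoc)
  have "contraction (W1 + W2)"
    unfolding contraction_def
  proof (intro allI, rule power2_le_imp_le)
    fix x
    have "orthogonal (W2 *v x) (W1 *v x)"
      unfolding W1x W2x using u compl_proj_orthogonal
      by (intro orthogonal_rvsum) (auto simp: orthogonal_def inner_commute)
    then have "(norm ((W1 + W2) *v x))\<^sup>2 = (norm (W2 *v x))\<^sup>2 + (norm (W1 *v x))\<^sup>2"
      using norm_add_Pythagorean
      by (simp add: matrix_vector_mult_add_rdistrib add.commute[of "W1 *v x"])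
    also have "(norm (W2 *v x))\<^sup>2 \<le> (norm (?Q *v x))\<^sup>2"
      unfolding W2x using W(1) norm_compl_proj_le[OF u]
      by (intro power_mono) (meson contraction_def order_trans, simp)
    also have "(norm (W1 *v x))\<^sup>2 = (\<Sum>i<r. (v i \<bullet> x)\<^sup>2)"
      unfolding W1x by (rule norm_sum_orthonormal_family[OF u])
    finally show "(norm ((W1 + W2) *v x))\<^sup>2 \<le> (norm x)\<^sup>2"
      using compl_proj_Pythagorean[OF v, of x] by simp
  qed simp
  then have "(W1 + W2) \<bullet> (A + proj_M_perp r u v D) \<le> nuclear_norm (A + proj_M_perp r u v D)"
    by (rule contraction_inner_le)
  moreover have M: "proj_M_perp r u v D \<in> M_perp r u v" "W2 \<in> M_perp r u v"
    using proj_M_perp_in[OF u v] by (auto simp: W2_def proj_M_perp_def)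
  moreover have "W1 \<bullet> proj_M_perp r u v D = 0" "W2 \<bullet> A = 0"
    using M by (auto simp: W1_def A_def inner_sum_left inner_sum_right outer_inner
        inner_commute[of W2] mem_M_perp_iff)
  moreover have "W2 \<bullet> proj_M_perp r u v D = nuclear_norm (proj_M_perp r u v D)"
    using proj_M_perp_orthogonal[OF M(1), of W] W(2)
    by (simp add: W2_def inner_diff_left flip: proj_M_perp_def)
  moreover have "W1 \<bullet> A = (\<Sum>i<r. s i)"
    proof -
    have "W1 \<bullet> (s i *\<^sub>R outer (u i) (v i)) = s i" if "i < r" for i
    proof -
      have "W1 *v v i = u i"
        unfolding W1x using v that
        by (subst sum.cong[OF refl, of _ _ "\<lambda>j. if j = i then u i else 0"])
          (auto simp: orthonormal_family_def)
      then show ?thesis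
        using u that by (simp add: inner_commute[of W1] outer_inner orthonormal_family_def)
    qed
    then show ?thesis
      unfolding A_def inner_sum_right by (intro sum.cong) auto
  qed
  moreover have "nuclear_norm A \<le> (\<Sum>i<r. s i)"
  proof -
    have "A = (\<Sum>i<r. outer (s i *\<^sub>R u i) (v i))"
      by (simp add: A_def outer_def vec_eq_iff mult_ac)
    also have "nuclear_norm \<dots> \<le> (\<Sum>i<r. norm (s i *\<^sub>R u i) * norm (v i))"
      by (rule nuclear_norm_sum_outer_le)
    also have "\<dots> = (\<Sum>i<r. s i)"
      using u v s by (intro sum.cong) (auto simp: orthonormal_family_def norm_eq_sqrt_inner)
    finally show ?thesis .
  qed
  ultimately show ?thesis by (simp add: inner_add_left inner_add_right)
qed

text \<open>
  The complementary projections annihilate the first \<open>r\<close> singular vectors and fix the others, so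
  the projection is the tail of the decomposition.
\<close>

lemma svd_minus_proj_M_perp:
  fixes A :: "real ^ 'p ^ 'k"
  assumes svd: "is_svd A u s v" and r: "r \<le> min CARD('k) CARD('p)"
  shows "A - proj_M_perp r u v A = (\<Sum>i<r. s i *\<^sub>R outer (u i) (v i))"
proof -
  define m where "m = min CARD('k) CARD('p)"
  have u: "orthonormal_family m u" and v: "orthonormal_family m v"
    and A: "A = (\<Sum>i<m. s i *\<^sub>R outer (u i) (v i))" and "r \<le> m"
    using svd r by (auto simp: is_svd_def Let_def m_def)
  have P: "compl_proj r w *v w i = (if i < r then 0 else w i)"
    if "orthonormal_family m w" "i < m" for w :: "nat \<Rightarrow> real ^ 'n" and i
  proof -
    have "(\<Sum>j<r. (w j \<bullet> w i) *\<^sub>R w j) = (\<Sum>j<r. if j = i then w i else 0)"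
      using that \<open>r \<le> m\<close> by (intro sum.cong) (auto simp: orthonormal_family_def)
    then show ?thesis by (simp add: compl_proj_mult_vec)
  qed
  have Ax: "A *v x = (\<Sum>i<m. (s i * (v i \<bullet> x)) *\<^sub>R u i)" for x
    by (simp add: A sum_mult_vec outer_mult_vec scaleR_matrix_vector_assoc[symmetric])
  have vQ: "v i \<bullet> (compl_proj r v *v x) = (if i < r then 0 else v i \<bullet> x)" if "i < m" for i x
  proof -
    have "v i \<bullet> (compl_proj r v *v x) = (compl_proj r v *v v i) \<bullet> x"
      by (metis dot_lmul_matrix transpose_matrix_vector transpose_compl_proj)
    then show ?thesis by (simp add: P[OF v that])
  qed
  have "proj_M_perp r u v A *v x = (\<Sum>i<m. if i < r then 0 else (s i * (v i \<bullet> x)) *\<^sub>R u i)" for x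
  proof -
    have "proj_M_perp r u v A *v x = compl_proj r u *v (A *v (compl_proj r v *v x))"
      by (simp add: proj_M_perp_def matrix_vector_mul_assoc matrix_mul_assoc)
    also have "\<dots> = (\<Sum>i<m. (s i * (v i \<bullet> (compl_proj r v *v x))) *\<^sub>R (compl_proj r u *v u i))"
      by (simp add: Ax linear_sum[OF matrix_vector_mul_linear] matrix_vector_mult_scaleR)
    also have "\<dots> = (\<Sum>i<m. if i < r then 0 else (s i * (v i \<bullet> x)) *\<^sub>R u i)"
      by (intro sum.cong) (auto simp: vQ P[OF u])
    finally show ?thesis .
  qed
  then have "(A - proj_M_perp r u v A) *v x
      = (\<Sum>i<m. if i < r then (s i * (v i \<bullet> x)) *\<^sub>R u i else 0)" for x
    by (simp add: matrix_vector_mult_diff_rdistrib Ax flip: sum_subtractf)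
      (intro sum.cong, auto)
  also have "(\<Sum>i<m. if i < r then (s i * (v i \<bullet> x)) *\<^sub>R u i else 0)
      = (\<Sum>i<r. s i *\<^sub>R outer (u i) (v i)) *v x" for x
    using \<open>r \<le> m\<close>
    by (simp add: sum_mult_vec outer_mult_vec scaleR_matrix_vector_assoc[symmetric])
      (intro sum.mono_neutral_cong_right, auto)
  finally show ?thesis by (simp add: matrix_eq)
qed

section \<open>The complementary part of the error has low rank\<close>

text \<open>
  By Bessel's inequality in every row, \<open>\<Sum>i<r. \<parallel>D v\<^sub>i\<parallel>\<^sup>2 \<le> \<parallel>D\<parallel>\<^sup>2\<close>; Cauchy-Schwarz over the \<open>r\<close> terms does
  the rest.
\<close>

lemma sum_norm_mult_vec_le:
  fixes D :: "real ^ 'p ^ 'k"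
  assumes v: "orthonormal_family r v"
  shows "(\<Sum>i<r. norm (D *v v i)) \<le> sqrt (real r) * norm D"
proof -
  have "(\<Sum>i<r. (norm (D *v v i))\<^sup>2) = (\<Sum>i<r. \<Sum>k\<in>UNIV. (v i \<bullet> D $ k)\<^sup>2)"
    by (simp add: power2_norm_eq_inner inner_vec_def[of "D *v _"] matrix_vector_mul_component
        inner_commute[of "D $ _"] flip: power2_eq_square)
  also have "\<dots> = (\<Sum>k\<in>UNIV. \<Sum>i<r. (v i \<bullet> D $ k)\<^sup>2)"
    by (rule sum.swap)
  also have "\<dots> \<le> (\<Sum>k\<in>UNIV. (norm (D $ k))\<^sup>2)"
  proof (rule sum_mono)
    fix k show "(\<Sum>i<r. (v i \<bullet> D $ k)\<^sup>2) \<le> (norm (D $ k))\<^sup>2"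
      using compl_proj_Pythagorean[OF v, of "D $ k"] by (smt (verit) zero_le_power2)
  qed
  also have "\<dots> = (norm D)\<^sup>2"
    by (simp add: power2_norm_eq_inner inner_vec_def[of D])
  finally have sq: "(\<Sum>i<r. (norm (D *v v i))\<^sup>2) \<le> (norm D)\<^sup>2" .
  have "(\<Sum>i<r. 1 * norm (D *v v i))\<^sup>2 \<le> (\<Sum>i<r. 1\<^sup>2) * (\<Sum>i<r. (norm (D *v v i))\<^sup>2)"
    by (rule Cauchy_Schwarz_ineq_sum)
  also have "\<dots> \<le> (sqrt (real r) * norm D)\<^sup>2"
    using sq by (simp add: power_mult_distrib mult_left_mono)
  finally show ?thesis
    by (intro power2_le_imp_le[of "\<Sum>i<r. norm (D *v v i)"]) simp_all
qed

text \<open>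
  With \<open>P\<close> and \<open>Q\<close> the complementary projections, \<open>D - P D Q = (I - P) D + P D (I - Q)\<close>, and both
  summands are sums of \<open>r\<close> rank-one matrices.
\<close>

lemma nuclear_norm_minus_proj_le:
  assumes u: "orthonormal_family r u" and v: "orthonormal_family r v"
  shows "nuclear_norm (D - proj_M_perp r u v D) \<le> 2 * sqrt (real r) * norm D"
proof -
  let ?P = "compl_proj r u" and ?Q = "compl_proj r v"
  let ?R = "\<Sum>i<r. outer (u i) (transpose D *v u i)"
  let ?C = "\<Sum>i<r. outer (?P *v (D *v v i)) (v i)"
  have "(D - proj_M_perp r u v D) *v x = (?R + ?C) *v x" for x
  proof -
    have vx: "?Q *v x = x - (\<Sum>i<r. (v i \<bullet> x) *\<^sub>R v i)"
      by (rule compl_proj_mult_vec)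
    have "proj_M_perp r u v D *v x = ?P *v (D *v (?Q *v x))"
      by (simp add: proj_M_perp_def matrix_vector_mul_assoc matrix_mul_assoc)
    also have "\<dots> = ?P *v (D *v x) - ?C *v x"
      by (simp add: vx matrix_vector_mult_diff_distrib linear_sum[OF matrix_vector_mul_linear]
          matrix_vector_mult_scaleR sum_mult_vec outer_mult_vec)
    also have "?P *v (D *v x) = D *v x - ?R *v x"
      by (simp add: compl_proj_mult_vec sum_mult_vec outer_mult_vec dot_lmul_matrix)
    finally show ?thesis
      by (simp add: matrix_vector_mult_diff_rdistrib matrix_vector_mult_add_rdistrib)
  qed
  then have "D - proj_M_perp r u v D = ?R + ?C"
    by (simp add: matrix_eq)
  also have "nuclear_norm \<dots> \<le> nuclear_norm ?R + nuclear_norm ?C"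
    by (rule nuclear_norm_triangle)
  also have "nuclear_norm ?R \<le> sqrt (real r) * norm D"
  proof -
    have "nuclear_norm ?R \<le> (\<Sum>i<r. norm (u i) * norm (transpose D *v u i))"
      by (rule nuclear_norm_sum_outer_le)
    also have "\<dots> = (\<Sum>i<r. norm (transpose D *v u i))"
      using u by (intro sum.cong) (auto simp: orthonormal_family_def norm_eq_sqrt_inner)
    also have "\<dots> \<le> sqrt (real r) * norm (transpose D)"
      by (rule sum_norm_mult_vec_le[OF u])
    also have "norm (transpose D) = norm D"
      by (simp add: norm_eq_sqrt_inner inner_transpose)
    finally show ?thesis .
  qed
  also have "nuclear_norm ?C \<le> sqrt (real r) * norm D"
  proof -
    have "nuclear_norm ?C \<le> (\<Sum>i<r. norm (?P *v (D *v v i)) * norm (v i))"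
      by (rule nuclear_norm_sum_outer_le)
    also have "\<dots> = (\<Sum>i<r. norm (?P *v (D *v v i)))"
      using v by (intro sum.cong) (auto simp: orthonormal_family_def norm_eq_sqrt_inner)
    also have "\<dots> \<le> (\<Sum>i<r. norm (D *v v i))"
      by (intro sum_mono norm_compl_proj_le[OF u])
    also have "\<dots> \<le> sqrt (real r) * norm D"
      by (rule sum_norm_mult_vec_le[OF v])
    finally show ?thesis .
  qed
  finally show ?thesis by (simp add: algebra_simps)
qed

section \<open>Trace regression with nuclear norm penalty\<close>

lemma trace_transpose_mult: "trace (transpose A ** B) = A \<bullet> B" for A B :: "real ^ 'p ^ 'k"
  by (simp add: trace_def matrix_matrix_mult_def transpose_def inner_vec_def) (rule sum.swap)

lemma inner_obs_op: "e \<bullet> obs_op X D = obs_adjoint X e \<bullet> D"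
  by (simp add: obs_op_def obs_adjoint_def trace_transpose_mult inner_vec_def[of e]
      inner_sum_left)

lemma obs_op_diff: "obs_op X (A - B) = obs_op X A - obs_op X B"
  by (simp add: obs_op_def vec_eq_iff trace_transpose_mult inner_diff_right)

theorem theorem1:
  fixes \<Theta>s \<Theta>hat :: "real ^ 'p ^ 'k"
    and X :: "'n::finite \<Rightarrow> real ^ 'p ^ 'k"
    and \<epsilon> y :: "real ^ 'n"
    and u :: "nat \<Rightarrow> real ^ 'k" and s :: "nat \<Rightarrow> real" and v :: "nat \<Rightarrow> real ^ 'p"
    and r :: nat and \<delta> \<kappa> lam :: real
  assumes y: "y = obs_op X \<Theta>s + \<epsilon>"
    and svd: "is_svd \<Theta>s u s v"
    and r: "1 \<le> r" "r \<le> min CARD('k) CARD('p)"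
    and \<delta>: "\<delta> \<ge> 0"
    and rsc: "restricted_strong_convexity X \<kappa> (error_set \<Theta>s u v r \<delta>)"
    and lam: "lam > 0" "lam \<ge> 2 * op_norm (obs_adjoint X \<epsilon>) / real CARD('n)"
    and solution: "is_arg_min (nuclear_objective X y lam) (\<lambda>_. True) \<Theta>hat"
  shows "norm (\<Theta>hat - \<Theta>s)
    \<le> Max {\<delta>, 32 * lam * sqrt (real r) / \<kappa>,
           sqrt (16 * lam * nuclear_norm (proj_M_perp r u v \<Theta>s) / \<kappa>)}"
proof -
  define D where "D = \<Theta>hat - \<Theta>s"
  define D2 where "D2 = proj_M_perp r u v D"
  define B where "B = proj_M_perp r u v \<Theta>s"
  define N where "N = real CARD('n)"
  have N: "N > 0" by (simp add: N_def)
  have u: "orthonormal_family r u" and v: "orthonormal_family r v" and s: "\<And>i. i < r \<Longrightarrow> s i \<ge> 0"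
    using svd r(2) unfolding is_svd_def Let_def by (auto elim!: orthonormal_family_mono)
  have "nuclear_objective X y lam \<Theta>hat \<le> nuclear_objective X y lam \<Theta>s"
    using solution by (auto simp: is_arg_min_def not_less)
  moreover have "y - obs_op X \<Theta>hat = \<epsilon> - obs_op X D" "y - obs_op X \<Theta>s = \<epsilon>"
    by (simp_all add: y D_def obs_op_diff)
  ultimately have "1 / (2 * N) * (norm (\<epsilon> - obs_op X D))\<^sup>2 + lam * nuclear_norm \<Theta>hat
      \<le> 1 / (2 * N) * (norm \<epsilon>)\<^sup>2 + lam * nuclear_norm \<Theta>s"
    by (simp add: nuclear_objective_def N_def)
  moreover have "(norm (\<epsilon> - obs_op X D))\<^sup>2
      = (norm \<epsilon>)\<^sup>2 - 2 * (obs_adjoint X \<epsilon> \<bullet> D) + (norm (obs_op X D))\<^sup>2"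
    by (simp add: power2_norm_eq_inner inner_diff_left inner_diff_right
        inner_commute[of "obs_op X D" \<epsilon>] inner_obs_op[of \<epsilon>])
  moreover have "1 / (2 * N) * (a - 2 * b + c) = 1 / (2 * N) * a - b / N + 1 / (2 * N) * c"
    for a b c :: real
    using N by (simp add: field_simps)
  ultimately have basic: "1 / (2 * N) * (norm (obs_op X D))\<^sup>2
      \<le> (obs_adjoint X \<epsilon> \<bullet> D) / N + lam * (nuclear_norm \<Theta>s - nuclear_norm \<Theta>hat)"
    by (simp add: right_diff_distrib)
  have "obs_adjoint X \<epsilon> \<bullet> D \<le> op_norm (obs_adjoint X \<epsilon>) * nuclear_norm D"
    by (rule inner_le_nuclear_norm[OF norm_le_op_norm])
  moreover have "op_norm (obs_adjoint X \<epsilon>) \<le> lam * N / 2"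
    using lam(2) N by (simp add: N_def field_simps)
  moreover have "nuclear_norm D \<ge> 0" by (rule nuclear_norm_nonneg)
  ultimately have "obs_adjoint X \<epsilon> \<bullet> D \<le> lam * N / 2 * nuclear_norm D"
    by (meson mult_right_mono order_trans)
  then have noise: "(obs_adjoint X \<epsilon> \<bullet> D) / N \<le> lam / 2 * nuclear_norm D"
    using N by (simp add: field_simps)
  have split: "nuclear_norm D \<le> nuclear_norm (D - D2) + nuclear_norm D2"
    using nuclear_norm_triangle[of "D - D2" D2] by simp
  have reg: "nuclear_norm \<Theta>s - nuclear_norm \<Theta>hat
      \<le> 2 * nuclear_norm B + nuclear_norm (D - D2) - nuclear_norm D2"
  proof -
    have "nuclear_norm (\<Theta>s - B) + nuclear_norm D2 \<le> nuclear_norm ((\<Theta>s - B) + D2)"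
      unfolding D2_def B_def svd_minus_proj_M_perp[OF svd r(2)]
      by (rule nuclear_norm_decomposable[OF u v s])
    \<comment> \<open>\<open>\<Theta>s - B + D2\<close> is \<open>\<Theta>hat\<close> up to \<open>D - D2\<close> and \<open>B\<close>, the two norms allowed in the bound.\<close>
    also have "(\<Theta>s - B) + D2 = \<Theta>hat + (- (D - D2) + - B)"
      by (simp add: D_def)
    also have "nuclear_norm \<dots> \<le> nuclear_norm \<Theta>hat + (nuclear_norm (- (D - D2)) + nuclear_norm (- B))"
      using nuclear_norm_triangle by (meson add_left_mono order_trans)
    finally show ?thesis
      using nuclear_norm_triangle[of "\<Theta>s - B" B] by (simp only: nuclear_norm_minus) simp
  qed
  have main: "1 / (2 * N) * (norm (obs_op X D))\<^sup>2
      \<le> lam * (2 * nuclear_norm B + 3 / 2 * nuclear_norm (D - D2) - 1 / 2 * nuclear_norm D2)"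
  proof -
    have "lam * (nuclear_norm D / 2 + (nuclear_norm \<Theta>s - nuclear_norm \<Theta>hat))
      \<le> lam * (2 * nuclear_norm B + 3 / 2 * nuclear_norm (D - D2) - 1 / 2 * nuclear_norm D2)"
      using split reg lam(1) by (intro mult_left_mono) auto
    with basic noise show ?thesis by (simp add: algebra_simps)
  qed
  have \<kappa>: "\<kappa> > 0" using rsc by (simp add: restricted_strong_convexity_def)
  show ?thesis
  proof (rule ccontr)
    assume "\<not> ?thesis"
    then have big: "\<delta> < norm D" "32 * lam * sqrt (real r) / \<kappa> < norm D"
      "sqrt (16 * lam * nuclear_norm B / \<kappa>) < norm D"
      by (auto simp: D_def B_def)
    have "0 \<le> lam * (2 * nuclear_norm B + 3 / 2 * nuclear_norm (D - D2) - 1 / 2 * nuclear_norm D2)"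
      using main N by (smt (verit) divide_nonneg_nonneg mult_nonneg_nonneg zero_le_power2)
    then have "nuclear_norm D2 \<le> 3 * nuclear_norm (D - D2) + 4 * nuclear_norm B"
      using lam(1) by (simp add: zero_le_mult_iff)
    then have "D \<in> error_set \<Theta>s u v r \<delta>"
      using big(1) by (simp add: error_set_def D2_def B_def)
    then have "\<kappa> * (norm D)\<^sup>2 \<le> 1 / (2 * N) * (norm (obs_op X D))\<^sup>2"
      using rsc by (simp add: restricted_strong_convexity_def N_def)
    also have "\<dots> \<le> lam * (2 * nuclear_norm B + 3 / 2 * nuclear_norm (D - D2) - 1 / 2 * nuclear_norm D2)"
      by (rule main)
    also have "\<dots> \<le> lam * (2 * nuclear_norm B + 3 * sqrt (real r) * norm D)"
    proof -
      have "nuclear_norm (D - D2) \<le> 2 * sqrt (real r) * norm D"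
        unfolding D2_def by (rule nuclear_norm_minus_proj_le[OF u v])
      moreover have "nuclear_norm D2 \<ge> 0" by (rule nuclear_norm_nonneg)
      ultimately show ?thesis using lam(1) by (intro mult_left_mono) auto
    qed
    \<comment> \<open>The two summands absorb \<open>2 = 16/8\<close> and \<open>3 = 32 * 3/32\<close> times the quantities in \<open>big(3)\<close> and \<open>big(2)\<close>.\<close>
    also have "\<dots> \<le> \<kappa> * (norm D)\<^sup>2 / 8 + 3 / 32 * (\<kappa> * (norm D)\<^sup>2)"
    proof -
      have "16 * lam * nuclear_norm B / \<kappa> \<le> (norm D)\<^sup>2"
        using big(3) by (metis less_imp_le sqrt_le_D)
      then have 1: "16 * lam * nuclear_norm B \<le> \<kappa> * (norm D)\<^sup>2"
        using \<kappa> by (simp add: field_simps)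
      have "32 * lam * sqrt (real r) \<le> \<kappa> * norm D"
        using big(2) \<kappa> by (simp add: field_simps)
      then have "32 * lam * sqrt (real r) * norm D \<le> \<kappa> * norm D * norm D"
        by (intro mult_right_mono) auto
      with 1 show ?thesis by (simp add: algebra_simps power2_eq_square)
    qed
    finally have "\<kappa> * (norm D)\<^sup>2 \<le> 0" by simp
    moreover have "norm D > 0" using big(1) \<delta> by linarith
    ultimately show False using \<kappa> by (simp add: mult_le_0_iff)
  qed
qed

end
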